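(* Let $p$ be an H-PCL formula with no occurrence of the standard implication $\rightarrow$. Then $p\vdash\lambda(p)$ is provable in PCL if and only if the contract automaton $\llbracket p\rrbracket$ admits weak agreement.
   Context: Contract automata: fix disjoint sets $\mathbb{R}$ (requests $a$) and $\mathbb{O}$ (offers $\overline a$), idle symbol $\Box$, $\Sigma=\mathbb{R}\cup\mathbb{O}\cup\{\Box\}$, $co$ swapping $a,\overline a$ and fixing $\Box$. $\vec a\in\Sigma^n$ is a request/offer on $\alpha$ if it is $\Box^{n_1}\alpha\Box^{n_2}$ with $\alpha\in\mathbb{R}$/$\mathbb{O}$, a match if $\Box^{n_1}\alpha\Box^{n_2}co(\alpha)\Box^{n_3}$; $\vec a\bowtie\vec b$ iff $\vec a$ is a request or offer on some $\alpha$ and $\vec b$ is respectively an offer or request on $co(\alpha)$. A CA of rank $n$ is $\langle Q,\vec q_0,A^r,A^o,T,F\rangle$, $Q=Q_1\times\cdots\times Q_n$, transition labels in $(A^r\cup A^o\cup\{\Box\})^n$ being requests, offers or matches, idle components not changing state; its language consists of label words of paths from $\vec q_0$ to $F$. Product of CAs of ranks $r_i$: states are concatenations, initial/final componentwise, transitions are either (i) a joint move of components $i<j$ with complementary labels, label $\Box^u\vec a_i\Box^v\vec a_j\Box^z$ padded to total rank, or (ii) a move of a single component $i$ padded by idles, allowed only if no other component has, in its current state, a transition with label complementary to $\vec a_i$. $\boxtimes$ (a-product) is the product of all rank-1 projections of the operands. Weak agreement: $\mathfrak{W}$ is the set of words $\vec a_1\ldots\vec a_m$ of rank $>1$ for which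 there is $f:[1..m]\to[1..m]$ total and injective on the indices of request actions with $f(i)=j$ only if $\vec a_i\bowtie\vec a_j$; a CA admits weak agreement iff its language meets $\mathfrak{W}$. H-PCL formulae: $p::=\bigwedge_{i\in I}\alpha_i$, $\alpha::=\bigwedge_{j\in J}a_j\mid(\bigwedge_{j\in J}a_j)\rightarrow b\mid(\bigwedge_{j\in J}a_j)\twoheadrightarrow b$, $|I|\ge2$, $|J|\ge1$, distinct $a_j$, $a_j\ne b$. $\lambda(p)$ is the conjunction of all atoms in $p$. Translation with $\mathcal{P}=\{q\cup\{\ast\}\mid q\subseteq J\}$: $\llbracket\bigwedge_i\alpha_i\rrbracket=\boxtimes_i\llbracket\alpha_i\rrbracket$; $\llbracket\bigwedge_j a_j\rrbracket$ has the single (initial and final) state $\{\ast\}$ and loops $(\{\ast\},\overline{a_j},\{\ast\})$; $\llbracket(\bigwedge_j a_j)\rightarrow b\rrbracket$ has states $\mathcal{P}$, initial $J\cup\{\ast\}$, final $\{\ast\}$, transitions $(J'\cup\{j\},a_j,J')$ ($j\in J$, $j\notin J'\in\mathcal P$) and $(\{\ast\},\overline b,\{\ast\})$; $\llbracket(\bigwedge_j a_j)\twoheadrightarrow b\rrbracket$ is the same but with loops $(q,\overline b,q)$ at every $q\in\mathcal{P}$. PCL sequent calculus: the intuitionistic rules $id$ ($\Gamma,p\vdash p$), $\wedge L1,\wedge L2,\wedge R,\vee L,\vee R1,\vee R2,cut$, $\rightarrow L$ (from $\Gamma,p\rightarrow q\vdash p$ and $\Gamma,p\rightarrow q,q\vdash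 r$ infer $\Gamma,p\rightarrow q\vdash r$), $\rightarrow R$, $\neg L$ (from $\Gamma,\neg p\vdash p$ infer $\Gamma,\neg p\vdash r$), $\neg R$ (from $\Gamma,p\vdash\bot$ infer $\Gamma\vdash\neg p$), $\bot L$, $\top R$, $weakR$ (from $\Gamma\vdash\bot$ infer $\Gamma\vdash p$), plus $Zero$: from $\Gamma\vdash q$ infer $\Gamma\vdash p\twoheadrightarrow q$; $Fix$: from $\Gamma,p\twoheadrightarrow q,r\vdash p$ and $\Gamma,p\twoheadrightarrow q,q\vdash r$ infer $\Gamma,p\twoheadrightarrow q\vdash r$; $PrePost$: from $\Gamma,p\twoheadrightarrow q,p'\vdash p$ and $\Gamma,p\twoheadrightarrow q,q\vdash q'$ infer $\Gamma,p\twoheadrightarrow q\vdash p'\twoheadrightarrow q'$. *)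

theory Defs
  imports Main
begin

text \<open>A name \<open>a\<close> yields the request \<open>a\<close> and the offer \<open>co a\<close>; vectors over the alphabet
  \<open>\<Sigma>\<close> are lists.\<close>

datatype 'a act = Req 'a | Off 'a | Idle

fun co :: "'a act \<Rightarrow> 'a act" where
  "co (Req a) = Off a"
| "co (Off a) = Req a"
| "co Idle = Idle"

definition idles :: "nat \<Rightarrow> 'a act list" where
  "idles n = replicate n Idle"

definition request_on :: "'a act \<Rightarrow> 'a act list \<Rightarrow> bool" where
  "request_on \<alpha> v \<longleftrightarrow> \<alpha> \<in> range Req \<and> (\<exists>n1 n2. v = idles n1 @ [\<alpha>] @ idles n2)"

definition offer_on :: "'a act \<Rightarrow> 'a act list \<Rightarrow> bool" where
  "offer_on \<alpha> v \<longleftrightarrow> \<alpha> \<in> range Off \<and> (\<exists>n1 n2. v = idles n1 @ [\<alpha>] @ idles n2)"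

definition match_on :: "'a act \<Rightarrow> 'a act list \<Rightarrow> bool" where
  "match_on \<alpha> v \<longleftrightarrow> \<alpha> \<in> range Req \<union> range Off \<and>
     (\<exists>n1 n2 n3. v = idles n1 @ [\<alpha>] @ idles n2 @ [co \<alpha>] @ idles n3)"

definition is_request :: "'a act list \<Rightarrow> bool" where
  "is_request v \<longleftrightarrow> (\<exists>\<alpha>. request_on \<alpha> v)"

definition is_offer :: "'a act list \<Rightarrow> bool" where
  "is_offer v \<longleftrightarrow> (\<exists>\<alpha>. offer_on \<alpha> v)"

definition is_match :: "'a act list \<Rightarrow> bool" where
  "is_match v \<longleftrightarrow> (\<exists>\<alpha>. match_on \<alpha> v)"

definition complementary :: "'a act list \<Rightarrow> 'a act list \<Rightarrow> bool" (infix "\<bowtie>" 50) where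
  "v \<bowtie> w \<longleftrightarrow> (\<exists>\<alpha>. request_on \<alpha> v \<and> offer_on (co \<alpha>) w \<or> offer_on \<alpha> v \<and> request_on (co \<alpha>) w)"

text \<open>The field \<open>comps\<close> is the list \<open>[Q\<^sub>1, \<dots>, Q\<^sub>n]\<close>, so the rank is its length and the
  state space is the Cartesian product of its entries, with states as lists.\<close>

record ('s, 'a) ca =
  comps :: "'s set list"
  init :: "'s list"
  reqs :: "'a act set"
  offs :: "'a act set"
  trans :: "('s list \<times> 'a act list \<times> 's list) set"
  final :: "'s list set"

definition rank :: "('s, 'a) ca \<Rightarrow> nat" where
  "rank A = length (comps A)"

definition states :: "('s, 'a) ca \<Rightarrow> 's list set" where
  "states A = listset (comps A)"

definition contract_automaton :: "('s, 'a) ca \<Rightarrow> bool" where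
  "contract_automaton A \<longleftrightarrow>
     rank A \<ge> 1 \<and> (\<forall>Q \<in> set (comps A). finite Q) \<and> init A \<in> states A \<and>
     finite (reqs A) \<and> reqs A \<subseteq> range Req \<and> finite (offs A) \<and> offs A \<subseteq> range Off \<and>
     final A \<subseteq> states A \<and>
     (\<forall>(q, v, q') \<in> trans A.
        q \<in> states A \<and> q' \<in> states A \<and>
        length v = rank A \<and> set v \<subseteq> reqs A \<union> offs A \<union> {Idle} \<and>
        (is_request v \<or> is_offer v \<or> is_match v) \<and>
        (\<forall>i < rank A. v ! i = Idle \<longrightarrow> q ! i = q' ! i))"

inductive run :: "('s, 'a) ca \<Rightarrow> 's list \<Rightarrow> 'a act list list \<Rightarrow> 's list \<Rightarrow> bool"
  for A where
  run_Nil: "run A q [] q"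
| run_Cons: "(q, v, q') \<in> trans A \<Longrightarrow> run A q' w q'' \<Longrightarrow> run A q (v # w) q''"

definition lang :: "('s, 'a) ca \<Rightarrow> 'a act list list set" where
  "lang A = {w. \<exists>q \<in> final A. run A (init A) w q}"

definition ranks :: "('s, 'a) ca list \<Rightarrow> nat" where
  "ranks As = sum_list (map rank As)"

definition joint_move ::
  "('s, 'a) ca list \<Rightarrow> 's list list \<Rightarrow> 'a act list \<Rightarrow> 's list list \<Rightarrow> bool" where
  "joint_move As qs c qs' \<longleftrightarrow>
     (\<exists>i j v\<^sub>i v\<^sub>j q\<^sub>i' q\<^sub>j'. i < j \<and> j < length As \<and>
        (qs ! i, v\<^sub>i, q\<^sub>i') \<in> trans (As ! i) \<and> (qs ! j, v\<^sub>j, q\<^sub>j') \<in> trans (As ! j) \<and> v\<^sub>i \<bowtie> v\<^sub>j \<and>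
        c = idles (ranks (take i As)) @ v\<^sub>i @ idles (ranks (drop (Suc i) (take j As))) @ v\<^sub>j
              @ idles (ranks (drop (Suc j) As)) \<and>
        qs' = qs[i := q\<^sub>i', j := q\<^sub>j'])"

definition single_move ::
  "('s, 'a) ca list \<Rightarrow> 's list list \<Rightarrow> 'a act list \<Rightarrow> 's list list \<Rightarrow> bool" where
  "single_move As qs c qs' \<longleftrightarrow>
     (\<exists>i v\<^sub>i q\<^sub>i'. i < length As \<and> (qs ! i, v\<^sub>i, q\<^sub>i') \<in> trans (As ! i) \<and>
        (\<forall>j < length As. j \<noteq> i \<longrightarrow>
           \<not> (\<exists>v\<^sub>j q\<^sub>j'. (qs ! j, v\<^sub>j, q\<^sub>j') \<in> trans (As ! j) \<and> v\<^sub>i \<bowtie> v\<^sub>j)) \<and>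
        c = idles (ranks (take i As)) @ v\<^sub>i @ idles (ranks (drop (Suc i) As)) \<and>
        qs' = qs[i := q\<^sub>i'])"

definition product :: "('s, 'a) ca list \<Rightarrow> ('s, 'a) ca" where
  "product As = \<lparr>
     comps = concat (map comps As),
     init = concat (map init As),
     reqs = \<Union> (reqs ` set As),
     offs = \<Union> (offs ` set As),
     trans = {(concat qs, c, concat qs') | qs c qs'.
                list_all2 (\<lambda>q A. q \<in> states A) qs As \<and>
                (joint_move As qs c qs' \<or> single_move As qs c qs')},
     final = {concat qs | qs. list_all2 (\<lambda>q A. q \<in> final A) qs As} \<rparr>"

definition projection :: "nat \<Rightarrow> ('s, 'a) ca \<Rightarrow> ('s, 'a) ca" where
  "projection i A = \<lparr>
     comps = [comps A ! i],
     init = [init A ! i],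
     reqs = {\<alpha> \<in> reqs A. \<exists>(q, v, q') \<in> trans A. v ! i = \<alpha>},
     offs = {\<alpha> \<in> offs A. \<exists>(q, v, q') \<in> trans A. v ! i = \<alpha>},
     trans = {([q ! i], [v ! i], [q' ! i]) | q v q'. (q, v, q') \<in> trans A \<and> v ! i \<noteq> Idle},
     final = {[q ! i] | q. q \<in> final A} \<rparr>"

definition a_product :: "('s, 'a) ca list \<Rightarrow> ('s, 'a) ca" where
  "a_product As = product (concat (map (\<lambda>A. map (\<lambda>i. projection i A) [0..<rank A]) As))"

text \<open>Words are indexed from \<open>0\<close>. The function of the definition is partial (hence \<open>\<rightharpoonup>\<close>), but
  has to be defined on all positions of requests.\<close>

definition request_positions :: "'a act list list \<Rightarrow> nat set" where
  "request_positions w = {i. i < length w \<and> is_request (w ! i)}"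

definition weak_agreement_words :: "'a act list list set" where
  "weak_agreement_words = {w.
     (\<exists>n > 1. \<forall>v \<in> set w. length v = n) \<and>
     (\<exists>f :: nat \<rightharpoonup> nat. dom f \<subseteq> {..<length w} \<and> ran f \<subseteq> {..<length w} \<and>
        request_positions w \<subseteq> dom f \<and> inj_on f (request_positions w) \<and>
        (\<forall>i j. f i = Some j \<longrightarrow> w ! i \<bowtie> w ! j))}"

definition admits_weak_agreement :: "('s, 'a) ca \<Rightarrow> bool" where
  "admits_weak_agreement A \<longleftrightarrow> lang A \<inter> weak_agreement_words \<noteq> {}"

datatype 'a pcl =
    Atom 'a
  | Top
  | Bot
  | Neg "'a pcl"
  | And "'a pcl" "'a pcl"
  | Or "'a pcl" "'a pcl"
  | Imp "'a pcl" "'a pcl"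
  | CImp "'a pcl" "'a pcl"  \<comment> \<open>contractual implication\<close>

text \<open>Contexts are sets, so \<open>\<Gamma>, p\<close> is \<open>insert p \<Gamma>\<close>. Read upwards every rule extends the context by
  at most one formula, so that derivations of sequents with a finite context only involve finite
  contexts.\<close>

inductive provable :: "'a pcl set \<Rightarrow> 'a pcl \<Rightarrow> bool" (infix "\<turnstile>" 50) where
  id: "insert p \<Gamma> \<turnstile> p"
| andL1: "insert p (insert (And p q) \<Gamma>) \<turnstile> r \<Longrightarrow> insert (And p q) \<Gamma> \<turnstile> r"
| andL2: "insert q (insert (And p q) \<Gamma>) \<turnstile> r \<Longrightarrow> insert (And p q) \<Gamma> \<turnstile> r"
| andR: "\<Gamma> \<turnstile> p \<Longrightarrow> \<Gamma> \<turnstile> q \<Longrightarrow> \<Gamma> \<turnstile> And p q"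
| orL: "insert p (insert (Or p q) \<Gamma>) \<turnstile> r \<Longrightarrow> insert q (insert (Or p q) \<Gamma>) \<turnstile> r
        \<Longrightarrow> insert (Or p q) \<Gamma> \<turnstile> r"
| orR1: "\<Gamma> \<turnstile> p \<Longrightarrow> \<Gamma> \<turnstile> Or p q"
| orR2: "\<Gamma> \<turnstile> q \<Longrightarrow> \<Gamma> \<turnstile> Or p q"
| impL: "insert (Imp p q) \<Gamma> \<turnstile> p \<Longrightarrow> insert q (insert (Imp p q) \<Gamma>) \<turnstile> r
         \<Longrightarrow> insert (Imp p q) \<Gamma> \<turnstile> r"
| impR: "insert p \<Gamma> \<turnstile> q \<Longrightarrow> \<Gamma> \<turnstile> Imp p q"
| negL: "insert (Neg p) \<Gamma> \<turnstile> p \<Longrightarrow> insert (Neg p) \<Gamma> \<turnstile> r"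
| negR: "insert p \<Gamma> \<turnstile> Bot \<Longrightarrow> \<Gamma> \<turnstile> Neg p"
| botL: "insert Bot \<Gamma> \<turnstile> p"
| topR: "\<Gamma> \<turnstile> Top"
| weakR: "\<Gamma> \<turnstile> Bot \<Longrightarrow> \<Gamma> \<turnstile> p"
| cut: "\<Gamma> \<turnstile> p \<Longrightarrow> insert p \<Gamma> \<turnstile> q \<Longrightarrow> \<Gamma> \<turnstile> q"
| Zero: "\<Gamma> \<turnstile> q \<Longrightarrow> \<Gamma> \<turnstile> CImp p q"
| Fix: "insert r (insert (CImp p q) \<Gamma>) \<turnstile> p \<Longrightarrow> insert q (insert (CImp p q) \<Gamma>) \<turnstile> r
        \<Longrightarrow> insert (CImp p q) \<Gamma> \<turnstile> r"
| PrePost: "insert p' (insert (CImp p q) \<Gamma>) \<turnstile> p \<Longrightarrow> insert q (insert (CImp p q) \<Gamma>) \<turnstile> q'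
        \<Longrightarrow> insert (CImp p q) \<Gamma> \<turnstile> CImp p' q'"

text \<open>An H-PCL formula is the list of its clauses, and the index set \<open>J\<close> of a clause with
  atoms \<open>as\<close> is the set of positions \<open>{..<length as}\<close>.\<close>

datatype 'a clause =
    Conj "'a list"
  | Impl "'a list" 'a
  | CImpl "'a list" 'a

type_synonym 'a hpcl = "'a clause list"

fun wf_clause :: "'a clause \<Rightarrow> bool" where
  "wf_clause (Conj as) \<longleftrightarrow> length as \<ge> 1 \<and> distinct as"
| "wf_clause (Impl as b) \<longleftrightarrow> length as \<ge> 1 \<and> distinct as \<and> b \<notin> set as"
| "wf_clause (CImpl as b) \<longleftrightarrow> length as \<ge> 1 \<and> distinct as \<and> b \<notin> set as"

definition is_hpcl :: "'a hpcl \<Rightarrow> bool" where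
  "is_hpcl p \<longleftrightarrow> length p \<ge> 2 \<and> (\<forall>c \<in> set p. wf_clause c)"

definition imp_free :: "'a hpcl \<Rightarrow> bool" where
  "imp_free p \<longleftrightarrow> (\<forall>as b. Impl as b \<notin> set p)"

fun big_and :: "'a pcl list \<Rightarrow> 'a pcl" where
  "big_and [] = Top"
| "big_and [p] = p"
| "big_and (p # q # ps) = And p (big_and (q # ps))"

fun clause_formula :: "'a clause \<Rightarrow> 'a pcl" where
  "clause_formula (Conj as) = big_and (map Atom as)"
| "clause_formula (Impl as b) = Imp (big_and (map Atom as)) (Atom b)"
| "clause_formula (CImpl as b) = CImp (big_and (map Atom as)) (Atom b)"

definition formula :: "'a hpcl \<Rightarrow> 'a pcl" where
  "formula p = big_and (map clause_formula p)"

fun clause_atoms :: "'a clause \<Rightarrow> 'a list" where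
  "clause_atoms (Conj as) = as"
| "clause_atoms (Impl as b) = as @ [b]"
| "clause_atoms (CImpl as b) = as @ [b]"

definition lambda :: "'a hpcl \<Rightarrow> 'a pcl" where
  "lambda p = big_and (map Atom (remdups (concat (map clause_atoms p))))"

text \<open>Local states are subsets of \<open>J \<union> {\<ast>}\<close>: the index \<open>j\<close> is \<open>Some j\<close> and \<open>\<ast>\<close> is \<open>None\<close>.\<close>

type_synonym index_set = "nat option set"

definition index_sets :: "'a list \<Rightarrow> index_set set" where
  "index_sets as = {insert None (Some ` J') | J'. J' \<subseteq> {..<length as}}"

definition consume_trans :: "'a list \<Rightarrow> (index_set list \<times> 'a act list \<times> index_set list) set" where
  "consume_trans as = {([insert (Some j) J'], [Req (as ! j)], [J']) | j J'.
     j < length as \<and> J' \<in> index_sets as \<and> Some j \<notin> J'}"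

fun clause_ca :: "'a clause \<Rightarrow> (index_set, 'a) ca" where
  "clause_ca (Conj as) = \<lparr>
     comps = [{{None}}],
     init = [{None}],
     reqs = {},
     offs = Off ` set as,
     trans = {([{None}], [Off (as ! j)], [{None}]) | j. j < length as},
     final = {[{None}]} \<rparr>"
| "clause_ca (Impl as b) = \<lparr>
     comps = [index_sets as],
     init = [insert None (Some ` {..<length as})],
     reqs = Req ` set as,
     offs = {Off b},
     trans = consume_trans as \<union> {([{None}], [Off b], [{None}])},
     final = {[{None}]} \<rparr>"
| "clause_ca (CImpl as b) = \<lparr>
     comps = [index_sets as],
     init = [insert None (Some ` {..<length as})],
     reqs = Req ` set as,
     offs = {Off b},
     trans = consume_trans as \<union> {([q], [Off b], [q]) | q. q \<in> index_sets as},
     final = {[{None}]} \<rparr>"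

definition hpcl_ca :: "'a hpcl \<Rightarrow> (index_set, 'a) ca" where
  "hpcl_ca p = a_product (map clause_ca p)"

lemma contract_automaton_rank1:
  assumes "comps A = [Q]" "finite Q" "init A = [q0]" "q0 \<in> Q"
    and "finite (reqs A)" "reqs A \<subseteq> range Req" "finite (offs A)" "offs A \<subseteq> range Off"
    and "\<And>x. x \<in> final A \<Longrightarrow> \<exists>q \<in> Q. x = [q]"
    and trans: "\<And>q v q'. (q, v, q') \<in> trans A \<Longrightarrow>
      \<exists>s \<in> Q. \<exists>s' \<in> Q. \<exists>\<alpha> \<in> reqs A \<union> offs A. q = [s] \<and> v = [\<alpha>] \<and> q' = [s']"
  shows "contract_automaton A"
proof -
  have states: "states A = (\<lambda>q. [q]) ` Q"
    using assms by (auto simp: states_def set_Cons_def)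
  have "[\<alpha>] = idles 0 @ [\<alpha>] @ idles 0" for \<alpha> :: "'b act"
    by (simp add: idles_def)
  then have label: "is_request [\<alpha>] \<or> is_offer [\<alpha>]" if "\<alpha> \<in> range Req \<union> range Off"
    for \<alpha> :: "'b act"
    using that unfolding is_request_def is_offer_def request_on_def offer_on_def by blast
  have "q \<in> states A \<and> q' \<in> states A \<and> length v = rank A \<and>
      set v \<subseteq> reqs A \<union> offs A \<union> {Idle} \<and> (is_request v \<or> is_offer v \<or> is_match v) \<and>
      (\<forall>i < rank A. v ! i = Idle \<longrightarrow> q ! i = q' ! i)"
    if "(q, v, q') \<in> trans A" for q v q'
  proof -
    obtain s s' \<alpha> where *: "s \<in> Q" "s' \<in> Q" "\<alpha> \<in> reqs A \<union> offs A"
        "q = [s]" "v = [\<alpha>]" "q' = [s']"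
      using trans \<open>(q, v, q') \<in> trans A\<close> by blast
    then have "\<alpha> \<in> range Req \<union> range Off"
      using assms(6,8) by blast
    with label[of \<alpha>] * assms(1) states show ?thesis
      by (auto simp: rank_def)
  qed
  moreover have "final A \<subseteq> states A"
    using assms(9) states by blast
  ultimately show ?thesis
    unfolding contract_automaton_def using assms(1-8) states by (auto simp: rank_def)
qed

lemma contract_automaton_clause_ca: "contract_automaton (clause_ca c)"
proof -
  have "index_sets as = (\<lambda>J. insert None (Some ` J)) ` Pow {..<length as}" for as :: "'a list"
    by (auto simp: index_sets_def)
  then have fin: "finite (index_sets as)" for as :: "'a list"
    by simp
  have index_setI: "insert None (Some ` J) \<in> index_sets as" if "J \<subseteq> {..<length as}"
    for as :: "'a list" and J
    using that unfolding index_sets_def by blast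
  have mem: "insert None (Some ` {..<length as}) \<in> index_sets as" "{None} \<in> index_sets as"
    for as :: "'a list"
    using index_setI[of "{..<length as}" as] index_setI[of "{}" as] by simp_all
  have ins: "insert (Some j) q \<in> index_sets as" if "q \<in> index_sets as" "j < length as"
    for as :: "'a list" and j q
  proof -
    from that(1) obtain J where J: "q = insert None (Some ` J)" "J \<subseteq> {..<length as}"
      unfolding index_sets_def by blast
    then show ?thesis
      using index_setI[of "insert j J" as] that(2) by (simp add: insert_commute)
  qed
  have consume: "\<exists>s \<in> index_sets as. \<exists>s' \<in> index_sets as. \<exists>\<alpha> \<in> Req ` set as \<union> offers.
      q = [s] \<and> v = [\<alpha>] \<and> q' = [s']"
    if "(q, v, q') \<in> consume_trans as" for q v q' and as :: "'a list" and offers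
  proof -
    from that obtain j J' where *: "j < length as" "J' \<in> index_sets as"
        "q = [insert (Some j) J']" "v = [Req (as ! j)]" "q' = [J']"
      unfolding consume_trans_def by blast
    moreover have "Req (as ! j) \<in> Req ` set as \<union> offers"
      using *(1) by simp
    ultimately show ?thesis
      using ins[OF *(2,1)] by blast
  qed
  show ?thesis
  proof (cases c)
    case (Conj as)
    show ?thesis
      by (rule contract_automaton_rank1[where Q = "{{None}}"]) (auto simp: Conj)
  next
    case (Impl as b)
    show ?thesis
    proof (rule contract_automaton_rank1[where Q = "index_sets as"])
      fix q v q' assume "(q, v, q') \<in> trans (clause_ca c)"
      then have "(q, v, q') \<in> consume_trans as \<or> q = [{None}] \<and> v = [Off b] \<and> q' = [{None}]"
        by (simp add: Impl) blast
      then show "\<exists>s \<in> index_sets as. \<exists>s' \<in> index_sets as.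
          \<exists>\<alpha> \<in> reqs (clause_ca c) \<union> offs (clause_ca c). q = [s] \<and> v = [\<alpha>] \<and> q' = [s']"
        using consume[of q v q' as "{Off b}"] mem(2)[of as] by (simp add: Impl) blast
    qed (auto simp: Impl fin mem)
  next
    case (CImpl as b)
    show ?thesis
    proof (rule contract_automaton_rank1[where Q = "index_sets as"])
      fix q v q' assume "(q, v, q') \<in> trans (clause_ca c)"
      then have "(q, v, q') \<in> consume_trans as \<or>
          (\<exists>s \<in> index_sets as. q = [s] \<and> v = [Off b] \<and> q' = [s])"
        by (simp add: CImpl) blast
      then show "\<exists>s \<in> index_sets as. \<exists>s' \<in> index_sets as.
          \<exists>\<alpha> \<in> reqs (clause_ca c) \<union> offs (clause_ca c). q = [s] \<and> v = [\<alpha>] \<and> q' = [s']"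
        using consume[of q v q' as "{Off b}"] by (simp add: CImpl) blast
    qed (auto simp: CImpl fin mem)
  qed
qed

end

(* Without standard implications, both sides say that every requested atom is also offered, i.e. is a
   fact or the conclusion of some clause.

   Logic: reading p ->> q as q turns PCL into classical logic and all the rules stay sound, so a
   requested atom that nobody offers can be made false without falsifying the formula. Conversely, Fix
   allows an atom to be assumed while the premises of the clause concluding it are being proved; hence
   induction on the number of offered atoms that are not assumed yet yields them all.

   Automata: a contractual clause can make its offer in every state, and reaches its final state only
   by making each of its requests. So if all requests are offered, they can all be fired in matches;
   and in a word with weak agreement each of them has to meet an offer. *)

theory Submission
  imports Defs
begin

section \<open>Requested and offered atoms of clauses\<close>

fun clause_reqs :: "'a clause \<Rightarrow> 'a list" where
  "clause_reqs (Conj as) = []"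
| "clause_reqs (Impl as b) = as"
| "clause_reqs (CImpl as b) = as"

text \<open>Offers form a set, while requests stay a list, because the local states of the clause
  automata refer to requests by position.\<close>

fun clause_offs :: "'a clause \<Rightarrow> 'a set" where
  "clause_offs (Conj as) = set as"
| "clause_offs (Impl as b) = {b}"
| "clause_offs (CImpl as b) = {b}"

definition requests_offered :: "'a hpcl \<Rightarrow> bool" where
  "requests_offered p \<longleftrightarrow> (\<forall>c \<in> set p. set (clause_reqs c) \<subseteq> \<Union> (clause_offs ` set p))"

lemma set_clause_atoms: "set (clause_atoms c) = set (clause_reqs c) \<union> clause_offs c"
  by (cases c) auto


section \<open>Provability in PCL\<close>

fun truth :: "('a \<Rightarrow> bool) \<Rightarrow> 'a pcl \<Rightarrow> bool" where
  "truth V (Atom a) \<longleftrightarrow> V a"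
| "truth V Top \<longleftrightarrow> True"
| "truth V Bot \<longleftrightarrow> False"
| "truth V (Neg p) \<longleftrightarrow> \<not> truth V p"
| "truth V (And p q) \<longleftrightarrow> truth V p \<and> truth V q"
| "truth V (Or p q) \<longleftrightarrow> truth V p \<or> truth V q"
| "truth V (Imp p q) \<longleftrightarrow> (truth V p \<longrightarrow> truth V q)"
| "truth V (CImp p q) \<longleftrightarrow> truth V q"

text \<open>A true \<open>CImp p q\<close> makes \<open>q\<close> true, so in \<open>Fix\<close> and
  \<open>PrePost\<close> the second premise alone gives the conclusion; \<open>Zero\<close> is
  immediate.\<close>

lemma provable_sound: "\<Gamma> \<turnstile> p \<Longrightarrow> \<forall>g \<in> \<Gamma>. truth V g \<Longrightarrow> truth V p"
  by (induction rule: provable.induct) auto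

lemma truth_big_and: "truth V (big_and ps) \<longleftrightarrow> (\<forall>p \<in> set ps. truth V p)"
  by (induction ps rule: big_and.induct) auto

lemma requests_offered_if_provable:
  assumes "imp_free p" and "{formula p} \<turnstile> lambda p"
  shows "requests_offered p"
  unfolding requests_offered_def
proof (intro ballI subsetI)
  fix c a assume "c \<in> set p" "a \<in> set (clause_reqs c)"
  \<comment> \<open>Exactly the offered atoms are true. Facts hold, a contractual clause counts as
    its conclusion, and standard implications are excluded by \<open>imp_free\<close>.\<close>
  let ?V = "\<lambda>x. x \<in> \<Union> (clause_offs ` set p)"
  have "truth ?V (clause_formula d)" if "d \<in> set p" for d
    by (cases d) (use that assms(1) in \<open>force simp: truth_big_and imp_free_def\<close>)+
  then have "truth ?V (lambda p)"
    using provable_sound[OF assms(2)] by (simp add: formula_def truth_big_and)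
  then show "?V a"
    using \<open>c \<in> set p\<close> \<open>a \<in> set (clause_reqs c)\<close>
    by (auto simp: lambda_def truth_big_and set_clause_atoms)
qed

section \<open>Weakening, conjunctions and derivation of the offered atoms\<close>

lemma provable_Un: "\<Gamma> \<turnstile> p \<Longrightarrow> \<Gamma> \<union> \<Delta> \<turnstile> p"
proof (induction rule: provable.induct)
  case (cut \<Gamma> p q)
  then show ?case
    using provable.cut[of "\<Gamma> \<union> \<Delta>" p q] by simp
qed (auto intro: provable.intros)

text \<open>The union form suits rule induction: each premise context is again
  \<open>\<Gamma> \<union> \<Delta>\<close> with formulas inserted, so the same rule
  applies.\<close>

lemma provable_mono: "\<Gamma> \<turnstile> p \<Longrightarrow> \<Gamma> \<subseteq> \<Delta> \<Longrightarrow> \<Delta> \<turnstile> p"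
  using provable_Un[of \<Gamma> p \<Delta>] by (simp add: Un_absorb1)

lemma provable_member: "p \<in> \<Gamma> \<Longrightarrow> \<Gamma> \<turnstile> p"
  using provable.id[of p \<Gamma>] by (simp add: insert_absorb)

lemma andE1: "\<Gamma> \<turnstile> And p q \<Longrightarrow> \<Gamma> \<turnstile> p"
  by (erule cut) (intro andL1 id)

lemma andE2: "\<Gamma> \<turnstile> And p q \<Longrightarrow> \<Gamma> \<turnstile> q"
  by (erule cut) (intro andL2 id)

lemma provable_big_and_iff: "\<Gamma> \<turnstile> big_and ps \<longleftrightarrow> (\<forall>p \<in> set ps. \<Gamma> \<turnstile> p)"
proof (induction ps rule: big_and.induct)
  case (3 p q ps)
  then show ?case
    by (auto intro: andR dest: andE1 andE2)
qed (auto intro: topR)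

text \<open>Both \<open>\<Gamma>\<close> and \<open>a\<close> must vary, since \<open>Fix\<close>
  enlarges the context and turns to the premises of the clause. The clauses are required to be
  derivable rather than members of \<open>\<Gamma>\<close>, which weakening preserves and which also
  covers the context \<open>{formula p}\<close>.\<close>

lemma offered_atom_provable:
  assumes "requests_offered p" and "imp_free p"
  shows "\<forall>c \<in> set p. \<Gamma> \<turnstile> clause_formula c \<Longrightarrow> a \<in> \<Union> (clause_offs ` set p) \<Longrightarrow> \<Gamma> \<turnstile> Atom a"
proof (induction "card {a \<in> \<Union> (clause_offs ` set p). Atom a \<notin> \<Gamma>}" arbitrary: \<Gamma> a rule: less_induct)
  case less
  let ?O = "\<Union> (clause_offs ` set p)"
  have fin: "finite (clause_offs c)" for c :: "'a clause"
    by (cases c) auto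
  show ?case
  proof (cases "Atom a \<in> \<Gamma>")
    case False
    obtain c where c: "c \<in> set p" "a \<in> clause_offs c"
      using less.prems by blast
    then have \<Gamma>c: "\<Gamma> \<turnstile> clause_formula c"
      using less.prems by blast
    show ?thesis
    proof (cases c)
      case (Conj as)
      then show ?thesis
        using \<Gamma>c c by (auto simp: provable_big_and_iff)
    next
      case (Impl as b)
      then show ?thesis
        using c assms(2) by (auto simp: imp_free_def)
    next
      case (CImpl as b)
      let ?prem = "big_and (map Atom as)"
      \<comment> \<open>The atom \<open>a\<close> itself leaves the counted set: it is offered and
        not yet assumed.\<close>
      have "card {x \<in> ?O. Atom x \<notin> insert (Atom a) \<Gamma>} < card {x \<in> ?O. Atom x \<notin> \<Gamma>}"
        using less.prems(2) False fin by (intro psubset_card_mono) auto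
      moreover have "\<forall>c \<in> set p. insert (Atom a) \<Gamma> \<turnstile> clause_formula c"
        using less.prems(1) provable_mono[OF _ subset_insertI] by blast
      ultimately have "insert (Atom a) \<Gamma> \<turnstile> Atom x" if "x \<in> ?O" for x
        using less.hyps that by blast
      moreover have "set as \<subseteq> ?O"
        using assms(1) c CImpl unfolding requests_offered_def by force
      ultimately have "insert (Atom a) \<Gamma> \<turnstile> ?prem"
        by (simp add: provable_big_and_iff subset_iff)
      then have "insert (Atom a) (insert (CImp ?prem (Atom a)) \<Gamma>) \<turnstile> ?prem"
        by (rule provable_mono) auto
      \<comment> \<open>In this instance of \<open>Fix\<close> the goal coincides with the
        conclusion of the clause, so the second branch is \<open>id\<close>. The clause formula is
        in the context only for this rule and is cut away afterwards.\<close>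
      then have "insert (CImp ?prem (Atom a)) \<Gamma> \<turnstile> Atom a"
        by (rule Fix) (rule id)
      then show ?thesis
        using \<Gamma>c CImpl c by (auto intro: cut)
    qed
  qed (rule provable_member)
qed

lemma provable_iff_requests_offered:
  assumes "imp_free p"
  shows "{formula p} \<turnstile> lambda p \<longleftrightarrow> requests_offered p"
proof
  assume p: "requests_offered p"
  have "\<forall>c \<in> set p. {formula p} \<turnstile> clause_formula c"
    using provable_member[of "formula p" "{formula p}"]
    by (simp add: formula_def provable_big_and_iff)
  then have "{formula p} \<turnstile> Atom a" if "a \<in> \<Union> (clause_offs ` set p)" for a
    using offered_atom_provable[OF p assms] that by blast
  moreover have "\<Union> (set ` clause_atoms ` set p) \<subseteq> \<Union> (clause_offs ` set p)"
    using p by (auto simp: set_clause_atoms requests_offered_def)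
  ultimately show "{formula p} \<turnstile> lambda p"
    by (auto simp: lambda_def provable_big_and_iff subset_iff)
qed (rule requests_offered_if_provable[OF assms])


section \<open>Products of rank-one automata\<close>

text \<open>The shape of the transitions is demanded separately, because the record type does not
  tie \<open>trans\<close> to \<open>comps\<close>.\<close>

definition rank_one :: "('s, 'a) ca \<Rightarrow> bool" where
  "rank_one A \<longleftrightarrow> (\<exists>Q. comps A = [Q]) \<and>
     (\<forall>t \<in> trans A. \<exists>s \<alpha> s'. t = ([s], [\<alpha>], [s']))"

lemma rank_oneE:
  assumes "rank_one A" "(q, v, q') \<in> trans A"
  obtains s \<alpha> s' where "q = [s]" "v = [\<alpha>]" "q' = [s']"
  using assms unfolding rank_one_def by blast

lemma ranks_rank_one: "\<forall>A \<in> set As. rank_one A \<Longrightarrow> ranks As = length As"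
  by (induction As) (auto simp: ranks_def rank_def rank_one_def)

text \<open>Every local state is a one-element list, so a concatenated state determines its
  decomposition.\<close>

lemma concat_rank_one_states:
  assumes "list_all2 (\<lambda>q A. q \<in> states A) qs As" and "\<forall>A \<in> set As. rank_one A"
  shows "qs = map (\<lambda>s. [s]) (concat qs)"
  using assms
  by (induction rule: list_all2_induct) (auto simp: rank_one_def states_def set_Cons_def)

text \<open>Turns padding into an update of the idle vector, so that labels are described by their
  active positions only.\<close>

lemma list_update_idles:
  "i < n \<Longrightarrow> (idles n)[i := \<alpha>] = idles i @ [\<alpha>] @ idles (n - Suc i)"
  by (rule nth_equalityI) (auto simp: idles_def nth_append nth_list_update nth_Cons split: nat.split)

lemma list_update_idles2:
  assumes "i < j" "j < n"
  shows "(idles n)[i := \<alpha>, j := \<beta>] =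
    idles i @ [\<alpha>] @ idles (j - Suc i) @ [\<beta>] @ idles (n - Suc j)"
  by (rule nth_equalityI)
    (use assms in \<open>auto simp: idles_def nth_append nth_list_update nth_Cons split: nat.split\<close>)

lemma concat_map_singleton_update:
  "concat ((map (\<lambda>s. [s]) q)[i := [s']]) = q[i := s']"
  by (simp flip: map_update[of "\<lambda>s. [s]"])

text \<open>With the concatenation undone, both kinds of move become updates of the state list and
  of the idle vector at the positions of the active components.\<close>

lemma product_rank_oneE:
  assumes "(q, v, q') \<in> trans (product As)" and As: "\<forall>A \<in> set As. rank_one A"
  obtains (joint) i j \<alpha> \<beta> s t where "i < j" "j < length As" "length q = length As"
      "([q ! i], [\<alpha>], [s]) \<in> trans (As ! i)" "([q ! j], [\<beta>], [t]) \<in> trans (As ! j)"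
      "[\<alpha>] \<bowtie> [\<beta>]" "v = (idles (length As))[i := \<alpha>, j := \<beta>]" "q' = q[i := s, j := t]"
    | (single) i \<alpha> s where "i < length As" "length q = length As"
      "([q ! i], [\<alpha>], [s]) \<in> trans (As ! i)" "v = (idles (length As))[i := \<alpha>]" "q' = q[i := s]"
proof -
  obtain qs qs' where q: "q = concat qs" "q' = concat qs'"
    and st: "list_all2 (\<lambda>q A. q \<in> states A) qs As"
    and move: "joint_move As qs v qs' \<or> single_move As qs v qs'"
    using assms(1) unfolding product_def by auto
  have qs: "qs = map (\<lambda>s. [s]) q"
    using concat_rank_one_states[OF st As] q by simp
  have len: "length q = length As"
    using list_all2_lengthD[OF st] by (simp add: qs)
  \<comment> \<open>All components have rank one, so the lengths of the idle blocks are differences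
    of positions.\<close>
  have ranks: "ranks (take i As) = min i (length As)" "ranks (drop i As) = length As - i"
    "ranks (drop i (take j As)) = min j (length As) - i" for i j
    using As by (subst ranks_rank_one; auto dest: in_set_takeD in_set_dropD)+
  from move show thesis
  proof
    assume "joint_move As qs v qs'"
    then obtain i j v\<^sub>i v\<^sub>j q\<^sub>i' q\<^sub>j' where ij: "i < j" "j < length As"
      and tr: "(qs ! i, v\<^sub>i, q\<^sub>i') \<in> trans (As ! i)" "(qs ! j, v\<^sub>j, q\<^sub>j') \<in> trans (As ! j)"
      and co: "v\<^sub>i \<bowtie> v\<^sub>j"
      and v: "v = idles (ranks (take i As)) @ v\<^sub>i @ idles (ranks (drop (Suc i) (take j As))) @ v\<^sub>j
        @ idles (ranks (drop (Suc j) As))"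
      and qs': "qs' = qs[i := q\<^sub>i', j := q\<^sub>j']"
      unfolding joint_move_def by blast
    have "rank_one (As ! i)" "rank_one (As ! j)"
      using As ij by auto
    then obtain \<alpha> s \<beta> t where eq: "v\<^sub>i = [\<alpha>]" "q\<^sub>i' = [s]" "v\<^sub>j = [\<beta>]" "q\<^sub>j' = [t]"
      using tr rank_oneE by metis
    have "v = (idles (length As))[i := \<alpha>, j := \<beta>]"
      using v ij by (simp add: eq ranks list_update_idles2)
    moreover have "q' = q[i := s, j := t]"
      unfolding q(2) qs' qs eq
      by (simp flip: map_update[of "\<lambda>s. [s]"])
    ultimately show thesis
      using joint ij len tr co by (simp add: eq qs)
  next
    assume "single_move As qs v qs'"
    then obtain i v\<^sub>i q\<^sub>i' where i: "i < length As"
      and tr: "(qs ! i, v\<^sub>i, q\<^sub>i') \<in> trans (As ! i)"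
      and v: "v = idles (ranks (take i As)) @ v\<^sub>i @ idles (ranks (drop (Suc i) As))"
      and qs': "qs' = qs[i := q\<^sub>i']"
      unfolding single_move_def by blast
    have "rank_one (As ! i)"
      using As i by auto
    then obtain \<alpha> s where eq: "v\<^sub>i = [\<alpha>]" "q\<^sub>i' = [s]"
      using tr rank_oneE by metis
    have "v = (idles (length As))[i := \<alpha>]"
      using v i by (simp add: eq ranks list_update_idles)
    moreover have "q' = q[i := s]"
      by (simp add: q(2) qs' qs eq concat_map_singleton_update)
    ultimately show thesis
      using single i len tr by (simp add: eq qs)
  qed
qed

lemma trans_product_jointI:
  "list_all2 (\<lambda>q A. q \<in> states A) qs As \<Longrightarrow> joint_move As qs c qs' \<Longrightarrow>
    (concat qs, c, concat qs') \<in> trans (product As)"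
  unfolding product_def by auto

text \<open>Introduction is stated for joint moves, as the runs constructed later consist of
  matches.\<close>

lemma product_rank_one_jointI:
  assumes As: "\<forall>A \<in> set As. rank_one A" and q: "list_all2 (\<lambda>s A. [s] \<in> states A) q As"
    and ij: "i < j" "j < length As"
    and tr: "([q ! i], [\<alpha>], [s]) \<in> trans (As ! i)" "([q ! j], [\<beta>], [t]) \<in> trans (As ! j)"
    and co: "[\<alpha>] \<bowtie> [\<beta>]"
  shows "(q, (idles (length As))[i := \<alpha>, j := \<beta>], q[i := s, j := t]) \<in> trans (product As)"
proof -
  let ?qs = "map (\<lambda>s. [s]) q"
  let ?v = "(idles (length As))[i := \<alpha>, j := \<beta>]"
  have len: "length q = length As"
    using q by (rule list_all2_lengthD)
  have ranks: "ranks (take i As) = min i (length As)" "ranks (drop i As) = length As - i"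
    "ranks (drop i (take j As)) = min j (length As) - i" for i j
    using As by (subst ranks_rank_one; auto dest: in_set_takeD in_set_dropD)+
  have v: "?v = idles (ranks (take i As)) @ [\<alpha>] @ idles (ranks (drop (Suc i) (take j As))) @ [\<beta>]
      @ idles (ranks (drop (Suc j) As))"
    using ij by (simp add: ranks list_update_idles2)
  have "(?qs ! i, [\<alpha>], [s]) \<in> trans (As ! i)" "(?qs ! j, [\<beta>], [t]) \<in> trans (As ! j)"
    using ij tr len by simp_all
  with v have "joint_move As ?qs ?v (?qs[i := [s], j := [t]])"
    unfolding joint_move_def using ij co by blast
  moreover have "list_all2 (\<lambda>q A. q \<in> states A) ?qs As"
    using q by (simp add: list_all2_map1)
  ultimately have "(concat ?qs, ?v, concat (?qs[i := [s], j := [t]])) \<in> trans (product As)"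
    by (intro trans_product_jointI)
  then show ?thesis
    by (simp flip: map_update[of "\<lambda>s. [s]"])
qed


section \<open>Clause automata\<close>

lemma rank_one_clause_ca: "rank_one (clause_ca c)"
  by (cases c) (auto simp: rank_one_def consume_trans_def)

lemma trans_clause_ca_not_Idle: "([s], [\<alpha>], [s']) \<in> trans (clause_ca c) \<Longrightarrow> \<alpha> \<noteq> Idle"
  by (cases c) (auto simp: consume_trans_def)

abbreviation clause_proj :: "'a clause \<Rightarrow> (index_set, 'a) ca" where
  "clause_proj c \<equiv> projection 0 (clause_ca c)"

lemma trans_projectionI:
  "(q, v, q') \<in> trans A \<Longrightarrow> v ! i \<noteq> Idle \<Longrightarrow> ([q ! i], [v ! i], [q' ! i]) \<in> trans (projection i A)"
  by (auto simp: projection_def)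

text \<open>Projection discards only transitions that idle in the chosen component; a clause
  automaton has a single component and no idle label.\<close>

lemma trans_clause_proj [simp]: "trans (clause_proj c) = trans (clause_ca c)"
proof -
  have *: "\<exists>s \<alpha> s'. q = [s] \<and> v = [\<alpha>] \<and> q' = [s'] \<and> \<alpha> \<noteq> Idle"
    if "(q, v, q') \<in> trans (clause_ca c)" for q v q'
    using that rank_oneE[OF rank_one_clause_ca that] trans_clause_ca_not_Idle by metis
  show ?thesis
  proof (intro equalityI subsetI)
    fix t assume "t \<in> trans (clause_proj c)"
    then obtain q v q' where "t = ([q ! 0], [v ! 0], [q' ! 0])" "(q, v, q') \<in> trans (clause_ca c)"
      by (auto simp: projection_def)
    then show "t \<in> trans (clause_ca c)"
      using *[of q v q'] by auto
  next
    fix t assume t: "t \<in> trans (clause_ca c)"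
    then obtain s \<alpha> s' where "t = ([s], [\<alpha>], [s'])" "\<alpha> \<noteq> Idle"
      using * by (metis prod_cases3)
    with t show "t \<in> trans (clause_proj c)"
      using trans_projectionI[of "[s]" "[\<alpha>]" "[s']" "clause_ca c" 0] by simp
  qed
qed

lemma clause_proj_simps [simp]:
  "comps (clause_proj c) = comps (clause_ca c)"
  "init (clause_proj c) = init (clause_ca c)"
  "final (clause_proj c) = {[{None}]}"
  by (cases c; simp add: projection_def)+

lemma rank_one_clause_proj: "rank_one (clause_proj c)"
  using rank_one_clause_ca[of c] by (simp add: rank_one_def)

text \<open>Each clause automaton has rank one and hence contributes exactly one projection.\<close>

lemma hpcl_ca_eq: "hpcl_ca p = product (map clause_proj p)"
proof -
  have "rank (clause_ca c) = 1" for c :: "'a clause"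
    by (cases c) (simp_all add: rank_def)
  then show ?thesis
    by (induction p) (simp_all add: hpcl_ca_def a_product_def o_def)
qed

definition clause_init :: "'a clause \<Rightarrow> index_set" where
  "clause_init c = hd (init (clause_ca c))"

lemma init_clause_ca: "init (clause_ca c) = [clause_init c]"
  by (cases c) (simp_all add: clause_init_def)

lemma init_hpcl_ca: "init (hpcl_ca p) = map clause_init p"
  by (induction p) (simp_all add: hpcl_ca_eq product_def init_clause_ca)

lemma final_hpcl_ca: "final (hpcl_ca p) = {replicate (length p) {None}}"
proof -
  have "list_all2 (\<lambda>q A. q \<in> final A) qs (map clause_proj p) \<longleftrightarrow>
      qs = replicate (length p) [{None}]" for qs
    by (induction p arbitrary: qs) (auto simp: list_all2_Cons2)
  then have "final (hpcl_ca p) = {concat (replicate (length p) [{None}])}"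
    by (auto simp: hpcl_ca_eq product_def)
  then show ?thesis
    by (induction p) (simp_all add: concat_replicate_single)
qed

text \<open>An element \<open>Some j\<close> of a local state stands for a request that is still
  pending; initially all of them are.\<close>

lemma Some_in_clause_init: "j < length (clause_reqs c) \<Longrightarrow> Some j \<in> clause_init c"
  by (cases c) (auto simp: clause_init_def)

lemma clause_init_in_states: "[clause_init c] \<in> states (clause_ca c)"
  using contract_automaton_clause_ca[of c] by (simp add: contract_automaton_def init_clause_ca)

lemma trans_clause_ca_Off: "([s], [Off a], [s']) \<in> trans (clause_ca c) \<Longrightarrow> a \<in> clause_offs c"
  by (cases c) (auto simp: consume_trans_def)

text \<open>Offers are loops, and a consuming transition removes only the index of its own
  request.\<close>

lemma trans_clause_ca_removes:
  "([s], [\<alpha>], [s']) \<in> trans (clause_ca c) \<Longrightarrow> Some j \<in> s \<Longrightarrow> Some j \<notin> s' \<Longrightarrow>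
    j < length (clause_reqs c) \<and> \<alpha> = Req (clause_reqs c ! j)"
  by (cases c) (auto simp: consume_trans_def)

text \<open>Facts loop at their only state and contractual clauses at every state, whereas an
  \<open>Impl\<close> clause offers only at \<open>{None}\<close>.\<close>

lemma trans_clause_ca_OffI:
  assumes "a \<in> clause_offs c" "[s] \<in> states (clause_ca c)" "\<forall>as b. c \<noteq> Impl as b"
  shows "([s], [Off a], [s]) \<in> trans (clause_ca c)"
  using assms by (cases c) (auto simp: states_def set_Cons_def in_set_conv_nth)

text \<open>A pending index rules out \<open>Conj\<close>, whose only state is
  \<open>{None}\<close>. As \<open>consume_trans\<close> builds the source from the target, the
  target is \<open>s - {Some j}\<close>, and inserting \<open>Some j\<close> gives back
  \<open>s\<close>.\<close>

lemma trans_clause_ca_ReqI: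
  assumes "[s] \<in> states (clause_ca c)" "Some j \<in> s"
  shows "j < length (clause_reqs c)"
    and "([s], [Req (clause_reqs c ! j)], [s - {Some j}]) \<in> trans (clause_ca c)"
    and "[s - {Some j}] \<in> states (clause_ca c)"
proof -
  have *: "j < length as \<and> s - {Some j} \<in> index_sets as \<and>
      ([s], [Req (as ! j)], [s - {Some j}]) \<in> consume_trans as" if s: "s \<in> index_sets as" for as :: "'a list"
  proof -
    obtain J where J: "s = insert None (Some ` J)" "J \<subseteq> {..<length as}"
      using s unfolding index_sets_def by blast
    then have j: "j < length as" "s - {Some j} = insert None (Some ` (J - {j}))"
      using assms(2) by auto
    then have "s - {Some j} \<in> index_sets as"
      using J unfolding index_sets_def by blast
    moreover from this have "([s], [Req (as ! j)], [s - {Some j}]) \<in> consume_trans as"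
      using j assms(2) unfolding consume_trans_def
      by (auto intro!: exI[of _ j] exI[of _ "s - {Some j}"])
    ultimately show ?thesis
      using j by blast
  qed
  show "j < length (clause_reqs c)"
    and "([s], [Req (clause_reqs c ! j)], [s - {Some j}]) \<in> trans (clause_ca c)"
    and "[s - {Some j}] \<in> states (clause_ca c)"
    using assms * by (cases c; auto simp: states_def set_Cons_def)+
qed

text \<open>Finiteness makes the cardinality drop when an index is removed;
  \<open>None \<in> s\<close> ensures that a state other than \<open>{None}\<close> has a pending
  request.\<close>

lemma index_set_state:
  assumes "[s] \<in> states (clause_ca c)"
  shows "finite s" and "None \<in> s"
proof -
  have *: "finite s \<and> None \<in> s" if "s \<in> index_sets as" for as :: "'a list"
    using that finite_subset[OF _ finite_lessThan] by (auto simp: index_sets_def)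
  show "finite s" and "None \<in> s"
    using assms * by (cases c; force simp: states_def set_Cons_def)+
qed


section \<open>Weak agreement\<close>

lemma request_on_singleton: "request_on (Req a) [Req a]" and offer_on_singleton: "offer_on (Off a) [Off a]"
  unfolding request_on_def offer_on_def idles_def by (auto intro!: exI[of _ 0])

lemma Req_complementary_Off: "[Req a] \<bowtie> [Off a]" and Off_complementary_Req: "[Off a] \<bowtie> [Req a]"
  unfolding complementary_def using request_on_singleton offer_on_singleton co.simps by metis+

lemma idles_singleton_eq: "idles n1 @ \<alpha> # idles n2 = [\<beta>] \<longleftrightarrow> n1 = 0 \<and> n2 = 0 \<and> \<alpha> = \<beta>"
  by (cases n1; cases n2) (auto simp: idles_def)

lemma complementary_singletonD: "[\<alpha>] \<bowtie> [\<beta>] \<Longrightarrow> \<beta> = co \<alpha>"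
  by (auto simp: complementary_def request_on_def offer_on_def idles_singleton_eq eq_commute[of "[_]"])

text \<open>Complementary one-letter labels determine each other, so a joint move is described by
  one letter \<open>\<alpha>\<close> and its partner \<open>co \<alpha>\<close>.\<close>

lemma trans_hpcl_caE:
  assumes "(q, v, q') \<in> trans (hpcl_ca p)"
  obtains (joint) i j \<alpha> s t where "i < j" "j < length p" "length q = length p"
      "([q ! i], [\<alpha>], [s]) \<in> trans (clause_ca (p ! i))"
      "([q ! j], [co \<alpha>], [t]) \<in> trans (clause_ca (p ! j))"
      "v = (idles (length p))[i := \<alpha>, j := co \<alpha>]" "q' = q[i := s, j := t]"
    | (single) i \<alpha> s where "i < length p" "length q = length p"
      "([q ! i], [\<alpha>], [s]) \<in> trans (clause_ca (p ! i))"
      "v = (idles (length p))[i := \<alpha>]" "q' = q[i := s]"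
proof -
  have p: "\<forall>A \<in> set (map clause_proj p). rank_one A"
    by (simp add: rank_one_clause_proj)
  have tr: "(q, v, q') \<in> trans (product (map clause_proj p))"
    using assms by (simp add: hpcl_ca_eq)
  show thesis
  proof (rule product_rank_oneE[OF tr p])
    fix i j \<alpha> \<beta> s t
    assume *: "i < j" "j < length (map clause_proj p)" "length q = length (map clause_proj p)"
      "([q ! i], [\<alpha>], [s]) \<in> trans (map clause_proj p ! i)"
      "([q ! j], [\<beta>], [t]) \<in> trans (map clause_proj p ! j)" "[\<alpha>] \<bowtie> [\<beta>]"
      "v = (idles (length (map clause_proj p)))[i := \<alpha>, j := \<beta>]" "q' = q[i := s, j := t]"
    then show thesis
      using joint[of i j \<alpha> s t] complementary_singletonD[of \<alpha> \<beta>] by simp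
  next
    fix i \<alpha> s
    assume "i < length (map clause_proj p)" "length q = length (map clause_proj p)"
      "([q ! i], [\<alpha>], [s]) \<in> trans (map clause_proj p ! i)"
      "v = (idles (length (map clause_proj p)))[i := \<alpha>]" "q' = q[i := s]"
    then show thesis
      using single[of i \<alpha> s] by simp
  qed
qed

section \<open>Offers and consumed requests along a run\<close>

lemma set_idles: "set (idles n) \<subseteq> {Idle}"
  by (auto simp: idles_def)

lemma trans_hpcl_ca_Off:
  assumes "(q, v, q') \<in> trans (hpcl_ca p)" "Off a \<in> set v"
  shows "a \<in> \<Union> (clause_offs ` set p)"
proof -
  have upd: "x \<in> set (xs[i := y]) \<Longrightarrow> x = y \<or> x \<in> set xs" for x y :: "'a act" and xs i
    using set_update_subset_insert by fastforce
  show ?thesis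
    using assms(1)
  proof (cases rule: trans_hpcl_caE)
    case (joint i j \<alpha> s t)
    then have "Off a = \<alpha> \<or> Off a = co \<alpha>"
      using assms(2) upd set_idles by blast
    then have "a \<in> clause_offs (p ! i) \<or> a \<in> clause_offs (p ! j)"
      using joint trans_clause_ca_Off by metis
    then show ?thesis
      using joint by (meson UN_I less_trans nth_mem)
  next
    case (single i \<alpha> s)
    then have "Off a = \<alpha>"
      using assms(2) upd set_idles by blast
    then show ?thesis
      using single trans_clause_ca_Off by (metis UN_I nth_mem)
  qed
qed

text \<open>Component \<open>k\<close> must be active and its letter is the request. In a joint move
  its partner contributes the matching offer to the label; in a single move the whole label is the
  request.\<close>

lemma trans_hpcl_ca_removes:
  assumes "(q, v, q') \<in> trans (hpcl_ca p)" "k < length p" "Some j \<in> q ! k" "Some j \<notin> q' ! k"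
  shows "Off (clause_reqs (p ! k) ! j) \<in> set v \<or> request_on (Req (clause_reqs (p ! k) ! j)) v"
  using assms(1)
proof (cases rule: trans_hpcl_caE)
  case (joint i i' \<alpha> s t)
  have mem: "\<alpha> \<in> set v" "co \<alpha> \<in> set v"
    using joint by (auto simp: idles_def set_conv_nth nth_list_update)
  have "k = i \<or> k = i'"
    using assms(3,4) joint by (metis nth_list_update_neq)
  then show ?thesis
  proof
    assume "k = i"
    then have "\<alpha> = Req (clause_reqs (p ! k) ! j)"
      using joint assms by (intro trans_clause_ca_removes[THEN conjunct2]) auto
    then show ?thesis
      using mem by auto
  next
    assume "k = i'"
    then have "co \<alpha> = Req (clause_reqs (p ! k) ! j)"
      using joint assms by (intro trans_clause_ca_removes[THEN conjunct2]) auto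
    then have "\<alpha> = Off (clause_reqs (p ! k) ! j)"
      by (cases \<alpha>) auto
    then show ?thesis
      using mem by auto
  qed
next
  case (single i \<alpha> s)
  have "k = i"
    using assms(3,4) single by (metis nth_list_update_neq)
  then have "\<alpha> = Req (clause_reqs (p ! k) ! j)"
    using single assms by (intro trans_clause_ca_removes[THEN conjunct2]) auto
  then show ?thesis
    using single by (auto simp: request_on_def list_update_idles)
qed

lemma run_hpcl_ca_Off:
  "run (hpcl_ca p) q w q' \<Longrightarrow> v \<in> set w \<Longrightarrow> Off a \<in> set v \<Longrightarrow> a \<in> \<Union> (clause_offs ` set p)"
  by (induction rule: run.induct) (auto dest: trans_hpcl_ca_Off)

lemma run_hpcl_ca_removes:
  assumes "run (hpcl_ca p) q w q'" "k < length p" "Some j \<in> q ! k" "Some j \<notin> q' ! k"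
  shows "\<exists>v \<in> set w. Off (clause_reqs (p ! k) ! j) \<in> set v \<or>
    request_on (Req (clause_reqs (p ! k) ! j)) v"
  using assms
proof (induction rule: run.induct)
  case (run_Cons q v q' w q'')
  then show ?case
    using trans_hpcl_ca_removes[OF run_Cons.hyps(1)] by (cases "Some j \<in> q' ! k") auto
qed simp

lemma request_on_Req_iff: "request_on \<alpha> v \<Longrightarrow> (Req a \<in> set v \<longleftrightarrow> \<alpha> = Req a) \<and> Off a \<notin> set v"
  by (auto simp: request_on_def idles_def)

lemma offer_on_Off_iff: "offer_on \<alpha> v \<Longrightarrow> (Off a \<in> set v \<longleftrightarrow> \<alpha> = Off a) \<and> Req a \<notin> set v"
  by (auto simp: offer_on_def idles_def)

lemma complementary_requestD: "request_on (Req a) v \<Longrightarrow> v \<bowtie> w \<Longrightarrow> Off a \<in> set w"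
  unfolding complementary_def using request_on_Req_iff offer_on_Off_iff co.simps(1) by metis

text \<open>The final state has no pending index, so each request is consumed along the accepting
  run, either in a match, which shows the offer, or as a request label, which \<open>f\<close> sends
  to a label with the offer. Any offer in a label comes from some clause.\<close>

lemma requests_offered_if_weak_agreement:
  assumes "admits_weak_agreement (hpcl_ca p)"
  shows "requests_offered p"
  unfolding requests_offered_def
proof (intro ballI subsetI)
  fix c a assume "c \<in> set p" "a \<in> set (clause_reqs c)"
  then obtain k j where k: "k < length p" "p ! k = c"
    and j: "j < length (clause_reqs c)" "clause_reqs c ! j = a"
    by (meson in_set_conv_nth)
  obtain w f where run: "run (hpcl_ca p) (map clause_init p) w (replicate (length p) {None})"
    and f: "request_positions w \<subseteq> dom f" "ran f \<subseteq> {..<length w}"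
      "\<forall>i j. f i = Some j \<longrightarrow> w ! i \<bowtie> w ! j"
    using assms unfolding admits_weak_agreement_def lang_def weak_agreement_words_def
    by (auto simp: final_hpcl_ca init_hpcl_ca)
  have "\<exists>v \<in> set w. Off (clause_reqs (p ! k) ! j) \<in> set v \<or>
      request_on (Req (clause_reqs (p ! k) ! j)) v"
    using run_hpcl_ca_removes[OF run k(1), of j] Some_in_clause_init[OF j(1)] k by simp
  then obtain v where v: "v \<in> set w" "Off a \<in> set v \<or> request_on (Req a) v"
    using k j by auto
  have "\<exists>v \<in> set w. Off a \<in> set v"
  proof (cases "request_on (Req a) v")
    case True
    obtain i where i: "i < length w" "w ! i = v"
      using v by (meson in_set_conv_nth)
    \<comment> \<open>\<open>f\<close> is defined at this position, and its value is the position of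
      the complementary offer.\<close>
    then have "i \<in> request_positions w"
      using True by (auto simp: request_positions_def is_request_def)
    then obtain l where "f i = Some l"
      using f by auto
    then have "l < length w" "v \<bowtie> w ! l"
      using f i by (auto intro: ranI)
    then show ?thesis
      using complementary_requestD[OF True] nth_mem by blast
  qed (use v in auto)
  then show "a \<in> \<Union> (clause_offs ` set p)"
    using run_hpcl_ca_Off[OF run] by blast
qed

section \<open>Construction of an accepting run of matches\<close>

lemma hpcl_ca_match:
  assumes q: "list_all2 (\<lambda>s c. [s] \<in> states (clause_ca c)) q p"
    and ik: "i < length p" "k < length p" "i \<noteq> k"
    and tr: "([q ! i], [Req a], [s]) \<in> trans (clause_ca (p ! i))"
      "([q ! k], [Off a], [q ! k]) \<in> trans (clause_ca (p ! k))"
  obtains v where "(q, v, q[i := s]) \<in> trans (hpcl_ca p)" "length v = length p" "\<not> is_request v"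
proof
  let ?v = "(idles (length p))[i := Req a, k := Off a]"
  have p: "\<forall>A \<in> set (map clause_proj p). rank_one A"
    by (simp add: rank_one_clause_proj)
  have q': "list_all2 (\<lambda>s A. [s] \<in> states A) q (map clause_proj p)"
    using q by (simp add: list_all2_map2 states_def)
  \<comment> \<open>The offer is a loop, so only component \<open>i\<close> changes state. Updates
    at distinct positions commute, hence both orders of \<open>i\<close> and \<open>k\<close> give
    the same label and target.\<close>
  have upd: "q[i := s, k := q ! k] = q[i := s]" "q[k := q ! k, i := s] = q[i := s]"
    "(idles (length p))[k := Off a, i := Req a] = ?v"
    using ik(3) by (metis list_update_id list_update_swap)+
  consider "i < k" | "k < i"
    using ik by linarith
  then show "(q, ?v, q[i := s]) \<in> trans (hpcl_ca p)"
  proof cases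
    case 1
    then show ?thesis
      using product_rank_one_jointI[OF p q' 1, of "Req a" s "Off a" "q ! k"] ik tr
      by (simp add: hpcl_ca_eq Req_complementary_Off upd)
  next
    case 2
    then show ?thesis
      using product_rank_one_jointI[OF p q' 2, of "Off a" "q ! k" "Req a" s] ik tr
      by (simp add: hpcl_ca_eq Off_complementary_Req upd)
  qed
  show "length ?v = length p"
    by (simp add: idles_def)
  \<comment> \<open>A request label has a single active letter, so an offer letter excludes
    it.\<close>
  have "Off a \<in> set ?v"
    using ik by (simp add: idles_def set_update_memI)
  then show "\<not> is_request ?v"
    by (auto simp: is_request_def dest: request_on_Req_iff[of _ _ a])
qed

text \<open>Induction on the total size of the local states: each match consumes one pending request
  and leaves the offering component where it is. The start state is arbitrary because it changes
  with every match.\<close>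

lemma hpcl_ca_matching_run:
  assumes p: "is_hpcl p" "imp_free p" "requests_offered p"
  shows "list_all2 (\<lambda>s c. [s] \<in> states (clause_ca c)) q p \<Longrightarrow>
    \<exists>w. run (hpcl_ca p) q w (replicate (length p) {None}) \<and>
      (\<forall>v \<in> set w. length v = length p \<and> \<not> is_request v)"
proof (induction "\<Sum>s\<leftarrow>q. card s" arbitrary: q rule: less_induct)
  case less
  have len: "length q = length p"
    using less.prems by (rule list_all2_lengthD)
  have st: "[q ! i] \<in> states (clause_ca (p ! i))" if "i < length p" for i
    using less.prems that by (simp add: list_all2_conv_all_nth)
  show ?case
  proof (cases "q = replicate (length p) {None}")
    case True
    then show ?thesis
      by (auto intro!: exI[of _ "[]"] run_Nil)
  next
    case False
    then obtain i where i: "i < length p" "q ! i \<noteq> {None}"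
      using len by (metis nth_equalityI length_replicate nth_replicate)
    then obtain x where "x \<in> q ! i" "x \<noteq> None"
      using index_set_state(2)[OF st[OF i(1)]] by blast
    then obtain j where j: "Some j \<in> q ! i"
      by auto
    let ?s = "q ! i - {Some j}"
    let ?a = "clause_reqs (p ! i) ! j"
    note req = trans_clause_ca_ReqI[OF st[OF i(1)] j]
    have mem: "p ! i \<in> set p"
      using i by simp
    then have "?a \<in> \<Union> (clause_offs ` set p)"
      using p(3) req(1) unfolding requests_offered_def by (meson nth_mem subsetD)
    then obtain k where k: "k < length p" "?a \<in> clause_offs (p ! k)"
      by (metis UN_E in_set_conv_nth)
    have "wf_clause (p ! i)"
      using p(1) mem by (simp add: is_hpcl_def)
    \<comment> \<open>A well-formed clause never offers an atom that it requests, so the partner is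
      another component, as a match demands.\<close>
    then have "i \<noteq> k"
      using k req(1) by (cases "p ! i") auto
    have "\<forall>as b. p ! k \<noteq> Impl as b"
      using p(2) k unfolding imp_free_def by (metis nth_mem)
    then have off: "([q ! k], [Off ?a], [q ! k]) \<in> trans (clause_ca (p ! k))"
      using trans_clause_ca_OffI[OF k(2) st[OF k(1)]] by blast
    obtain v where v: "(q, v, q[i := ?s]) \<in> trans (hpcl_ca p)" "length v = length p" "\<not> is_request v"
      using hpcl_ca_match[OF less.prems i(1) k(1) \<open>i \<noteq> k\<close> req(2) off] .
    have "list_all2 (\<lambda>s c. [s] \<in> states (clause_ca c)) (q[i := ?s]) p"
      using st req(3) len i(1) by (auto simp: list_all2_conv_all_nth nth_list_update)
    moreover have "(\<Sum>s\<leftarrow>q[i := ?s]. card s) < (\<Sum>s\<leftarrow>q. card s)"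
    proof -
      have "card ?s < card (q ! i)"
        using j index_set_state(1)[OF st[OF i(1)]] by (intro card_Diff1_less)
      moreover have "card (q ! i) \<le> (\<Sum>s\<leftarrow>q. card s)"
        using i len by (simp add: member_le_sum_list)
      ultimately show ?thesis
        using i len by (simp add: map_update sum_list_update)
    qed
    ultimately obtain w where "run (hpcl_ca p) (q[i := ?s]) w (replicate (length p) {None})"
      "\<forall>v \<in> set w. length v = length p \<and> \<not> is_request v"
      using less.hyps by blast
    then show ?thesis
      using v run_Cons[OF v(1)] by (intro exI[of _ "v # w"]) auto
  qed
qed

text \<open>The run found above has no request labels, so the empty map witnesses weak agreement;
  the rank exceeds one because an H-PCL formula has at least two clauses.\<close>

lemma weak_agreement_if_requests_offered:
  assumes "is_hpcl p" "imp_free p" "requests_offered p"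
  shows "admits_weak_agreement (hpcl_ca p)"
proof -
  have "list_all2 (\<lambda>s c. [s] \<in> states (clause_ca c)) (map clause_init p) p"
    by (simp add: list_all2_conv_all_nth clause_init_in_states)
  then obtain w where w: "run (hpcl_ca p) (map clause_init p) w (replicate (length p) {None})"
    "\<forall>v \<in> set w. length v = length p \<and> \<not> is_request v"
    using hpcl_ca_matching_run[OF assms] by blast
  have "w \<in> lang (hpcl_ca p)"
    using w by (simp add: lang_def final_hpcl_ca init_hpcl_ca)
  moreover have "request_positions w = {}"
    using w by (auto simp: request_positions_def)
  moreover have "length p > 1"
    using assms(1) by (simp add: is_hpcl_def)
  ultimately have "w \<in> weak_agreement_words"
    unfolding weak_agreement_words_def using w(2)
    by (intro CollectI conjI exI[of _ "length p"] exI[of _ "Map.empty"]) auto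
  with \<open>w \<in> lang (hpcl_ca p)\<close> show ?thesis
    unfolding admits_weak_agreement_def by blast
qed

theorem theorem5p9:
  fixes p :: "'a hpcl"
  assumes "is_hpcl p" and "imp_free p"
  shows "{formula p} \<turnstile> lambda p \<longleftrightarrow> admits_weak_agreement (hpcl_ca p)"
  using provable_iff_requests_offered[OF assms(2)] requests_offered_if_weak_agreement
    weak_agreement_if_requests_offered[OF assms] by blast

end
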